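(* Let $G=(A,B,E)$ be a bipartite graph with $n=|A|$ and $m=|B|$, whose edge set is partitioned as $E=E_1\cup E_2$ with $E_1$ given to Alice and $E_2$ given to Bob. Then there are one-way two-party deterministic communication protocols (Alice sends one message to Bob, who outputs a semi-matching of $G$) for the semi-matching problem, one with (1) message size $c\,n\log m$ and approximation factor $n^{1/2}+2$, and another one with (2) message size $2c\,n\log m$ and approximation factor $2n^{1/3}+2$, where $c$ is a constant. Here a protocol has approximation factor $\beta$ if the output semi-matching $S$ satisfies $\operatorname{deg}_{\max} S\le\beta\cdot\operatorname{deg}_{\max}S^*$, $S^*$ an optimal semi-matching of $G$.
   Context: For $E'\subseteq E$, $\deg_{E'}(v)$ is the number of edges of $E'$ at $v$ and $\operatorname{deg}_{\max}E'=\max_{v\in A\cup B}\deg_{E'}(v)$. A semi-matching of $G$ is a set $S\subseteq E$ with $\deg_S(a)=1$ for all $a\in A$ (it is assumed $G$ has one). A degree-minimizing path with respect to $S$ is a path $b_1,a_1,b_2,\dots,a_{k-1},b_k$ ($k\ge2$) with $(a_i,b_i)\in S$, $(a_i,b_{i+1})\in E\setminus S$, $\deg_S(b_1)\ge\deg_S(b_k)+2$; an optimal semi-matching is one admitting no degree-minimizing path, and all optimal semi-matchings have the same (minimum possible) maximum degree. Message size is measured in bits. *)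

theory Defs
  imports Complex_Main
begin

text \<open>An edge is a pair \<open>(a, b)\<close> with its endpoint in \<open>A\<close> first.\<close>

type_synonym 'v edges = "('v \<times> 'v) set"

definition bipartite_graph :: "'v set \<Rightarrow> 'v set \<Rightarrow> 'v edges \<Rightarrow> bool" where
  "bipartite_graph A B E \<longleftrightarrow> finite A \<and> finite B \<and> A \<inter> B = {} \<and> E \<subseteq> A \<times> B"

definition deg :: "'v edges \<Rightarrow> 'v \<Rightarrow> nat" where
  "deg E v = card {e \<in> E. fst e = v \<or> snd e = v}"

definition deg_max :: "'v set \<Rightarrow> 'v set \<Rightarrow> 'v edges \<Rightarrow> nat" where
  "deg_max A B E = Max (deg E ` (A \<union> B))"

definition semi_matching :: "'v set \<Rightarrow> 'v edges \<Rightarrow> 'v edges \<Rightarrow> bool" where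
  "semi_matching A E S \<longleftrightarrow> S \<subseteq> E \<and> (\<forall>a\<in>A. deg S a = 1)"

text \<open>The path \<open>b\<^sub>1, a\<^sub>1, b\<^sub>2, \<dots>, a\<^sub>k\<^sub>-\<^sub>1, b\<^sub>k\<close> is given by the lists
  \<open>bs = [b\<^sub>1, \<dots>, b\<^sub>k]\<close> and \<open>as = [a\<^sub>1, \<dots>, a\<^sub>k\<^sub>-\<^sub>1]\<close>, indexed from \<open>0\<close>.\<close>

definition degree_minimizing_path ::
  "'v edges \<Rightarrow> 'v edges \<Rightarrow> 'v list \<Rightarrow> 'v list \<Rightarrow> bool" where
  "degree_minimizing_path E S bs as \<longleftrightarrow>
     length bs \<ge> 2 \<and> length bs = length as + 1 \<and> distinct (bs @ as) \<and>
     (\<forall>i < length as. (as ! i, bs ! i) \<in> S \<and> (as ! i, bs ! (i + 1)) \<in> E - S) \<and>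
     deg S (hd bs) \<ge> deg S (last bs) + 2"

definition optimal_semi_matching :: "'v set \<Rightarrow> 'v edges \<Rightarrow> 'v edges \<Rightarrow> bool" where
  "optimal_semi_matching A E S \<longleftrightarrow>
     semi_matching A E S \<and> (\<nexists>bs as. degree_minimizing_path E S bs as)"

text \<open>Alice's message depends on \<open>E\<^sub>1\<close> only, Bob's output on the message and \<open>E\<^sub>2\<close> only;
  the vertex sets are known to both. Inputs are promised to partition the edge set of a
  bipartite graph that has a semi-matching.\<close>

definition semi_matching_protocol ::
  "'v set \<Rightarrow> 'v set \<Rightarrow> ('v edges \<Rightarrow> bool list) \<Rightarrow> (bool list \<Rightarrow> 'v edges \<Rightarrow> 'v edges)
    \<Rightarrow> real \<Rightarrow> real \<Rightarrow> bool" where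
  "semi_matching_protocol A B alice bob L \<beta> \<longleftrightarrow>
     (\<forall>E\<^sub>1 E\<^sub>2. bipartite_graph A B (E\<^sub>1 \<union> E\<^sub>2) \<and> E\<^sub>1 \<inter> E\<^sub>2 = {} \<and>
        (\<exists>S. semi_matching A (E\<^sub>1 \<union> E\<^sub>2) S) \<longrightarrow>
        real (length (alice E\<^sub>1)) \<le> L \<and>
        semi_matching A (E\<^sub>1 \<union> E\<^sub>2) (bob (alice E\<^sub>1) E\<^sub>2) \<and>
        (\<forall>S'. optimal_semi_matching A (E\<^sub>1 \<union> E\<^sub>2) S' \<longrightarrow>
           real (deg_max A B (bob (alice E\<^sub>1) E\<^sub>2)) \<le> \<beta> * real (deg_max A B S')))"

end

theory Submission
  imports Defs "HOL-Library.FuncSet"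
begin

text \<open>Alice sends a sparse \<open>T \<subseteq> E\<^sub>1\<close> such that every set of vertices that \<open>E\<^sub>1\<close> can assign with
  load at most \<open>d\<close> can be assigned in \<open>T\<close> with load at most \<open>\<gamma> d\<close>. Splitting an optimal
  semi-matching into its \<open>E\<^sub>1\<close>-part and its \<open>E\<^sub>2\<close>-part shows that a best semi-matching of
  \<open>T \<union> E\<^sub>2\<close> is a \<open>(\<gamma> + 1)\<close>-approximation.

  For the first protocol \<open>T\<close> is the graph of a balanced assignment \<open>s\<close>, which gives
  \<open>\<gamma> = n\<^sup>1\<^sup>/\<^sup>2 + 1\<close>: if \<open>D\<close> of the given vertices are sent to the same \<open>b\<close>, their neighbourhood has
  at least \<open>D / d\<close> elements, each of load at least \<open>D - 1\<close>, so \<open>D (D - 1) \<le> d n\<close>.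

  For the second one, \<open>T\<close> also contains the graph of an assignment \<open>t\<close> that is balanced on each
  fibre of \<open>s\<close>. Suppose that a set \<open>X\<close> violates Hall's condition, with \<open>Y\<close> its neighbourhood in \<open>T\<close>
  and \<open>|X| = \<mu> |Y|\<close>. If \<open>D\<^sub>b\<close> vertices of \<open>X\<close> lie in the fibre of \<open>b\<close>, of size \<open>\<sigma>\<^sub>b\<close>, the counting
  argument inside the fibre gives \<open>d \<sigma>\<^sub>b \<ge> D\<^sub>b\<^sup>2 / |Y| - D\<^sub>b\<close>, and for \<open>s\<close> itself it gives
  \<open>d n \<ge> \<Sum> D\<^sub>b (\<sigma>\<^sub>b - 1)\<close>. The power mean inequality turns this into \<open>\<mu>\<^sup>3 \<le> 4 d\<^sup>2 n\<close>, so
  \<open>\<gamma> = 2 n\<^sup>1\<^sup>/\<^sup>3 + 1\<close> suffices.\<close>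

section \<open>Loads and balanced assignments\<close>

definition assignment :: "'v set \<Rightarrow> 'v edges \<Rightarrow> ('v \<Rightarrow> 'v) \<Rightarrow> bool" where
  "assignment V E f \<longleftrightarrow> (\<forall>a\<in>V. (a, f a) \<in> E)"

definition load :: "'v set \<Rightarrow> ('v \<Rightarrow> 'v) \<Rightarrow> 'v \<Rightarrow> nat" where
  "load V f b = card {a \<in> V. f a = b}"

text \<open>Local optimality: no move of a single vertex evens out the loads. This excludes the
  degree-minimizing paths with two vertices in \<open>B\<close>; longer ones remain
  possible.\<close>

definition balanced :: "'v set \<Rightarrow> 'v edges \<Rightarrow> ('v \<Rightarrow> 'v) \<Rightarrow> bool" where
  "balanced V E s \<longleftrightarrow> assignment V E s \<and>
     (\<forall>a\<in>V. \<forall>z. (a, z) \<in> E \<longrightarrow> load V s (s a) \<le> Suc (load V s z))"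

text \<open>Alice cannot know which vertices Bob's edges will serve, so a single \<open>T\<close>
  has to work for all \<open>X\<close> and \<open>d\<close>. The condition \<open>1 \<le> d\<close>
  lets additive constants be absorbed into the factor \<open>\<gamma>\<close>.\<close>

definition skeleton :: "'v edges \<Rightarrow> 'v edges \<Rightarrow> real \<Rightarrow> bool" where
  "skeleton E T \<gamma> \<longleftrightarrow> T \<subseteq> E \<and>
     (\<forall>X f d. finite X \<and> assignment X E f \<and> 1 \<le> d \<and> (\<forall>b. load X f b \<le> d) \<longrightarrow>
        (\<exists>g. assignment X T g \<and> (\<forall>b. real (load X g b) \<le> \<gamma> * real d)))"

lemma load_mono: "finite V \<Longrightarrow> X \<subseteq> V \<Longrightarrow> load X f b \<le> load V f b"
  unfolding load_def by (rule card_mono) auto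

lemma load_fun_upd:
  assumes "finite V" "a \<in> V" "z \<noteq> s a"
  shows "load V (s(a := z)) b =
    (if b = z then Suc (load V s z) else if b = s a then load V s (s a) - 1 else load V s b)"
proof -
  consider "b = z" | "b = s a" | "b \<noteq> z" "b \<noteq> s a" by blast
  then show ?thesis
  proof cases
    case 1
    have "{x \<in> V. (s(a := z)) x = z} = insert a {x \<in> V. s x = z}" using assms by auto
    then show ?thesis using 1 assms by (simp add: load_def)
  next
    case 2
    have "{x \<in> V. (s(a := z)) x = s a} = {x \<in> V. s x = s a} - {a}" using assms by auto
    then show ?thesis using 2 assms by (simp add: load_def)
  next
    case 3
    have "{x \<in> V. (s(a := z)) x = b} = {x \<in> V. s x = b}" using 3 by auto
    then show ?thesis using 3 by (simp add: load_def)
  qed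
qed

text \<open>An assignment minimizing the sum of squared loads is balanced: moving a vertex from load
  p to load q with p >= q + 2 lowers this sum by 2 (p - q - 1).\<close>

lemma balanced_exists:
  assumes "finite V" "finite B" "E \<subseteq> UNIV \<times> B" "\<And>a. a \<in> V \<Longrightarrow> \<exists>b. (a, b) \<in> E"
  shows "\<exists>s. balanced V E s"
proof -
  define \<Phi> where "\<Phi> s = (\<Sum>b\<in>B. (load V s b)\<^sup>2)" for s
  have "\<exists>s. assignment V E s" unfolding assignment_def using assms(4) by metis
  then obtain s where s: "assignment V E s" and min: "\<And>s'. assignment V E s' \<Longrightarrow> \<Phi> s \<le> \<Phi> s'"
    using arg_min_nat_lemma[of "assignment V E" _ \<Phi>] by metis
  have "load V s (s a) \<le> Suc (load V s z)" if a: "a \<in> V" "(a, z) \<in> E" for a z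
  proof (rule ccontr)
    assume gt: "\<not> load V s (s a) \<le> Suc (load V s z)"
    then have ne: "z \<noteq> s a" by auto
    note upd = load_fun_upd[of V a z s, OF assms(1) a(1) ne]
    let ?s = "s(a := z)" and ?R = "B - {s a} - {z}"
    have "(a, s a) \<in> E" using s a by (simp add: assignment_def)
    then have B: "z \<in> B" "s a \<in> B" using a assms(3) by auto
    have split: "\<Phi> r = (load V r (s a))\<^sup>2 + ((load V r z)\<^sup>2 + (\<Sum>b\<in>?R. (load V r b)\<^sup>2))" for r
      unfolding \<Phi>_def using B ne assms(2)
      by (subst sum.remove[of B "s a"], simp, simp, subst sum.remove[of _ z]) auto
    have rest: "(\<Sum>b\<in>?R. (load V ?s b)\<^sup>2) = (\<Sum>b\<in>?R. (load V s b)\<^sup>2)"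
      by (rule sum.cong) (auto simp: upd)
    \<comment> \<open>Writing the larger load as a sum avoids truncated subtraction.\<close>
    obtain j where j: "load V s (s a) = load V s z + 2 + j"
      using gt by (metis not_less_eq_eq le_add_diff_inverse add_2_eq_Suc' )
    have "\<Phi> ?s < \<Phi> s"
      unfolding split[of ?s] split[of s] rest
      using ne j by (simp add: upd power2_eq_square)
    moreover have "assignment V E ?s" using s a by (auto simp: assignment_def)
    ultimately show False using min[of ?s] by simp
  qed
  then show ?thesis using s by (auto simp: balanced_def)
qed

lemma sum_load_eq_card:
  assumes "finite V" "finite B" "s ` V \<subseteq> B"
  shows "(\<Sum>b\<in>B. load V s b) = card V"
proof -
  have "card V = (\<Sum>b\<in>B. \<Sum>a | a \<in> V \<and> s a = b. 1)"
    using sum.group[OF assms, of "\<lambda>_. 1::nat"] by simp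
  then show ?thesis by (simp add: load_def)
qed

lemma sum_by_load:
  fixes h :: "'v \<Rightarrow> real"
  assumes "finite V" "finite B" "s ` V \<subseteq> B"
  shows "(\<Sum>a\<in>V. h (s a)) = (\<Sum>b\<in>B. real (load V s b) * h b)"
proof -
  have "(\<Sum>a\<in>V. h (s a)) = (\<Sum>b\<in>B. \<Sum>a | a \<in> V \<and> s a = b. h (s a))"
    using sum.group[OF assms, of "\<lambda>a. h (s a)"] by simp
  also have "\<dots> = (\<Sum>b\<in>B. real (load V s b) * h b)" by (simp add: load_def)
  finally show ?thesis .
qed

text \<open>For \<open>a\<close> in \<open>X\<close>, balance forces a load of at least
  \<open>load V s (s a) - 1\<close> at the alternative \<open>f a\<close>. Summing these loads
  counts pairs \<open>(a, x)\<close> with \<open>s x = f a\<close>, and each \<open>x\<close> in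
  \<open>V\<close> occurs in at most \<open>d\<close> of them.\<close>

lemma balanced_expansion:
  assumes "finite V" "balanced V E s" "X \<subseteq> V" "assignment X E f" "\<And>b. load X f b \<le> d"
  shows "(\<Sum>a\<in>X. real (load V s (s a)) - 1) \<le> real d * real (card V)"
proof -
  have fX: "finite X" using assms(1,3) finite_subset by blast
  have "real (load V s (s a)) - 1 \<le> real (load V s (f a))" if "a \<in> X" for a
  proof -
    have "load V s (s a) \<le> Suc (load V s (f a))"
      using that assms(2,3,4) by (auto simp: balanced_def assignment_def)
    then show ?thesis by linarith
  qed
  then have "(\<Sum>a\<in>X. real (load V s (s a)) - 1) \<le> (\<Sum>a\<in>X. real (load V s (f a)))"
    by (rule sum_mono)
  also have "\<dots> = (\<Sum>a\<in>X. \<Sum>x\<in>V. if s x = f a then 1 else 0)"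
    using assms(1) by (simp add: load_def sum.If_cases Int_def)
  also have "\<dots> = (\<Sum>x\<in>V. \<Sum>a\<in>X. if s x = f a then 1 else 0)" by (rule sum.swap)
  also have "\<dots> = (\<Sum>x\<in>V. real (load X f (s x)))"
    using fX by (simp add: load_def sum.If_cases Int_def eq_commute)
  also have "\<dots> \<le> (\<Sum>x\<in>V. real d)" using assms(5) by (intro sum_mono) simp
  finally show ?thesis by (simp add: mult.commute)
qed

section \<open>Hall's theorem with capacities\<close>

text \<open>Rado's proof: a set family that satisfies Hall's condition and is minimal
  under deletion of elements consists of singletons.\<close>

lemma Hall_capacity:
  fixes N :: "'v \<Rightarrow> 'v set"
  assumes "finite A" "\<And>a. a \<in> A \<Longrightarrow> finite (N a)"
    and "\<And>X. X \<subseteq> A \<Longrightarrow> card X \<le> \<Delta> * card (\<Union>(N ` X))"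
  shows "\<exists>g. (\<forall>a\<in>A. g a \<in> N a) \<and> (\<forall>b. load A g b \<le> \<Delta>)"
  using assms(2,3)
proof (induction "\<Sum>a\<in>A. card (N a)" arbitrary: N rule: less_induct)
  case less
  have ne: "N a \<noteq> {}" if "a \<in> A" for a
    using less.prems(2)[of "{a}"] that by auto
  show ?case
  proof (cases "\<forall>a\<in>A. \<exists>b. N a = {b}")
    case True
    then obtain g where g: "\<And>a. a \<in> A \<Longrightarrow> N a = {g a}" by metis
    \<comment> \<open>A fibre of \<open>g\<close> has the single neighbour \<open>b\<close>, so
      Hall's condition for it is the load bound.\<close>
    have "load A g b \<le> \<Delta>" for b
    proof (cases "\<exists>a\<in>A. g a = b")
      case True
      then have "\<Union>(N ` {a \<in> A. g a = b}) = {b}" using g by auto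
      then show ?thesis using less.prems(2)[of "{a \<in> A. g a = b}"] by (simp add: load_def)
    next
      case False
      then have "{a \<in> A. g a = b} = {}" by auto
      then show ?thesis unfolding load_def by (simp only: card.empty)
    qed
    then show ?thesis using g by auto
  next
    case False
    then obtain a x y where a: "a \<in> A" and xy: "x \<in> N a" "y \<in> N a" "x \<noteq> y"
      using ne by (metis all_not_in_conv insertE insert_absorb singletonI subset_singletonD subsetI)
    define M where "M z = N(a := N a - {z})" for z
    have ind: ?thesis
      if z: "z \<in> N a" and H: "\<And>X. X \<subseteq> A \<Longrightarrow> card X \<le> \<Delta> * card (\<Union>(M z ` X))" for z
    proof -
      have "(\<Sum>c\<in>A. card (M z c)) < (\<Sum>c\<in>A. card (N c))"
      proof (rule sum_strict_mono_ex1)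
        show "\<forall>c\<in>A. card (M z c) \<le> card (N c)"
          using less.prems(1) by (auto simp: M_def intro: card_mono)
        show "\<exists>c\<in>A. card (M z c) < card (N c)"
          using a card_Diff1_less[OF less.prems(1)[OF a] z]
          by (intro bexI[of _ a]) (simp_all only: M_def fun_upd_same)
      qed (fact assms(1))
      moreover have "finite (M z c)" if "c \<in> A" for c using less.prems(1)[OF that] less.prems(1)[OF a]
        by (simp add: M_def)
      ultimately obtain g where "\<forall>c\<in>A. g c \<in> M z c" "\<forall>b. load A g b \<le> \<Delta>"
        using less.hyps[of "M z"] H by blast
      moreover have "M z c \<subseteq> N c" for c by (auto simp: M_def)
      ultimately show ?thesis by blast
    qed
    \<comment> \<open>Deleting \<open>z\<close> from \<open>N a\<close> can break Hall's condition
      only for a set containing \<open>a\<close>. Dropping \<open>a\<close> lowers the size of that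
      set by one, which turns the strict inequality into \<open>\<le>\<close>.\<close>
    have viol: "\<exists>X \<subseteq> A - {a}. \<Delta> * card (\<Union>(N ` X) \<union> (N a - {z})) \<le> card X"
      if nz: "\<not> (\<forall>X \<subseteq> A. card X \<le> \<Delta> * card (\<Union>(M z ` X)))" for z
    proof -
      from nz obtain X where X: "X \<subseteq> A" "\<Delta> * card (\<Union>(M z ` X)) < card X"
        by (auto simp: not_le)
      have aX: "a \<in> X"
      proof (rule ccontr)
        assume "a \<notin> X"
        then have "M z ` X = N ` X" by (auto simp: M_def)
        then show False using X less.prems(2)[of X] by simp
      qed
      have "\<Union>(M z ` X) = \<Union>(N ` (X - {a})) \<union> (N a - {z})"
        using aX by (auto simp: M_def split: if_splits)
      moreover have "card X = Suc (card (X - {a}))"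
        using aX X(1) assms(1) by (metis card_Suc_Diff1 finite_subset)
      ultimately show ?thesis using X by (intro exI[of _ "X - {a}"]) auto
    qed
    show ?thesis
    proof (rule ccontr)
      assume no: "\<not> ?thesis"
      obtain X where X: "X \<subseteq> A - {a}" "\<Delta> * card (\<Union>(N ` X) \<union> (N a - {x})) \<le> card X"
        using ind[OF xy(1)] viol[of x] no by blast
      obtain Y where Y: "Y \<subseteq> A - {a}" "\<Delta> * card (\<Union>(N ` Y) \<union> (N a - {y})) \<le> card Y"
        using ind[OF xy(2)] viol[of y] no by blast
      let ?P = "\<Union>(N ` X) \<union> (N a - {x})" and ?Q = "\<Union>(N ` Y) \<union> (N a - {y})"
      have fXY: "finite X" "finite Y" using X Y assms(1) finite_subset by blast+
      have fPQ: "finite ?P" "finite ?Q"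
        using X Y fXY less.prems(1) a by auto
      \<comment> \<open>Since \<open>x\<close> and \<open>y\<close> differ, the two reduced copies
        of \<open>N a\<close> together give all of it.\<close>
      have "?P \<union> ?Q = \<Union>(N ` insert a (X \<union> Y))" using xy by auto
      moreover have "card (insert a (X \<union> Y)) \<le> \<Delta> * card (\<Union>(N ` insert a (X \<union> Y)))"
        using X Y a by (intro less.prems(2)) auto
      moreover have "card (insert a (X \<union> Y)) = Suc (card (X \<union> Y))"
        using X Y fXY by (subst card_insert_disjoint) auto
      ultimately have 1: "Suc (card (X \<union> Y)) \<le> \<Delta> * card (?P \<union> ?Q)" by simp
      have "card (X \<inter> Y) \<le> \<Delta> * card (\<Union>(N ` (X \<inter> Y)))"
        using X by (intro less.prems(2)) auto
      also have "\<dots> \<le> \<Delta> * card (?P \<inter> ?Q)"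
        using fPQ by (intro mult_left_mono card_mono) auto
      finally have 2: "card (X \<inter> Y) \<le> \<Delta> * card (?P \<inter> ?Q)" .
      \<comment> \<open>Submodularity: Hall's condition for the union with \<open>a\<close> and for
        the intersection adds up to one more than the two violations allow.\<close>
      have "Suc (card X + card Y) = Suc (card (X \<union> Y)) + card (X \<inter> Y)"
        using card_Un_Int[OF fXY] by simp
      also have "\<dots> \<le> \<Delta> * (card (?P \<union> ?Q) + card (?P \<inter> ?Q))"
        using 1 2 by (simp only: distrib_left)
      also have "\<dots> = \<Delta> * card ?P + \<Delta> * card ?Q"
        by (simp only: card_Un_Int[OF fPQ, symmetric] flip: distrib_left)
      also have "\<dots> \<le> card X + card Y" using X Y by linarith
      finally show False by simp
    qed
  qed
qed

section \<open>Power mean inequalities\<close>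

lemma sum_squares_ge:
  fixes D :: "'i \<Rightarrow> real" and \<mu> :: real
  assumes "finite Y" "(\<Sum>b\<in>Y. D b) = \<mu> * card Y"
  shows "\<mu>\<^sup>2 * card Y \<le> (\<Sum>b\<in>Y. (D b)\<^sup>2)"
proof -
  \<comment> \<open>The left side is the tangent to the square function at the mean
    \<open>\<mu>\<close>; its sum over \<open>Y\<close> depends only on the mean.\<close>
  have "2 * \<mu> * t - \<mu>\<^sup>2 \<le> t\<^sup>2" for t :: real
    using zero_le_power2[of "t - \<mu>"] by (simp add: power2_eq_square algebra_simps)
  then have "(\<Sum>b\<in>Y. 2 * \<mu> * D b - \<mu>\<^sup>2) \<le> (\<Sum>b\<in>Y. (D b)\<^sup>2)" by (intro sum_mono)
  moreover have "(\<Sum>b\<in>Y. 2 * \<mu> * D b - \<mu>\<^sup>2) = \<mu>\<^sup>2 * card Y"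
    using assms(2) by (simp add: sum_subtractf flip: sum_distrib_left) (simp add: power2_eq_square)
  ultimately show ?thesis by simp
qed

text \<open>Again a tangent at the mean: \<open>t ^ 3\<close> exceeds it by
  \<open>(t - \<mu>)\<^sup>2 * (t + 2 * \<mu>)\<close>, which is nonnegative for nonnegative
  \<open>t\<close> and \<open>\<mu>\<close>.\<close>

lemma sum_cubes_ge:
  fixes D :: "'i \<Rightarrow> real" and \<mu> :: real
  assumes "finite Y" "(\<Sum>b\<in>Y. D b) = \<mu> * card Y" "0 \<le> \<mu>" "\<And>b. b \<in> Y \<Longrightarrow> 0 \<le> D b"
  shows "\<mu> ^ 3 * card Y \<le> (\<Sum>b\<in>Y. D b ^ 3)"
proof -
  have "3 * \<mu>\<^sup>2 * t - 2 * \<mu> ^ 3 \<le> t ^ 3" if "0 \<le> t" for t :: real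
  proof -
    have "0 \<le> (t - \<mu>)\<^sup>2 * (t + 2 * \<mu>)" using that assms(3) by simp
    then show ?thesis by (simp add: power2_eq_square power3_eq_cube algebra_simps)
  qed
  then have "(\<Sum>b\<in>Y. 3 * \<mu>\<^sup>2 * D b - 2 * \<mu> ^ 3) \<le> (\<Sum>b\<in>Y. D b ^ 3)"
    using assms(4) by (intro sum_mono) blast
  moreover have "(\<Sum>b\<in>Y. 3 * \<mu>\<^sup>2 * D b - 2 * \<mu> ^ 3) = \<mu> ^ 3 * card Y"
    using assms(2) by (simp add: sum_subtractf flip: sum_distrib_left)
      (simp add: power2_eq_square power3_eq_cube)
  ultimately show ?thesis by simp
qed

section \<open>Skeletons from one and from two balanced assignments\<close>

lemma balanced_skeleton:
  assumes "finite A" "balanced A E s" "E \<subseteq> A \<times> B"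
  shows "skeleton E ((\<lambda>a. (a, s a)) ` A) (real (card A) powr (1/2) + 1)"
  unfolding skeleton_def
proof (intro conjI allI impI)
  show "(\<lambda>a. (a, s a)) ` A \<subseteq> E" using assms(2) by (auto simp: balanced_def assignment_def)
next
  fix X :: "'a set" and f d
  assume H: "finite X \<and> assignment X E f \<and> 1 \<le> d \<and> (\<forall>b. load X f b \<le> d)"
  let ?r = "real (card A) powr (1/2)"
  have XA: "X \<subseteq> A" using H assms(3) by (auto simp: assignment_def)
  have "real (load X s b) \<le> (?r + 1) * d" for b
  proof (rule ccontr)
    let ?D = "real (load X s b)"
    \<comment> \<open>Expansion is applied to one fibre, on which \<open>s\<close> is constant, so
      that the sum becomes a product.\<close>
    let ?Xb = "{a \<in> X. s a = b}"
    assume "\<not> ?D \<le> (?r + 1) * d"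
    then have gt: "?D > (?r + 1) * d" by simp
    have "assignment ?Xb E f" using H by (auto simp: assignment_def)
    moreover have "load ?Xb f c \<le> d" for c
      using H load_mono[of X ?Xb f c] by (auto intro: le_trans)
    ultimately have "(\<Sum>a\<in>?Xb. real (load A s (s a)) - 1) \<le> real d * real (card A)"
      using XA by (intro balanced_expansion[OF assms(1,2)]) auto
    then have "?D * (real (load A s b) - 1) \<le> d * card A" by (simp add: load_def)
    moreover have "?D * (?D - 1) \<le> ?D * (real (load A s b) - 1)"
      using load_mono[OF assms(1) XA, of s b] by (intro mult_left_mono) auto
    ultimately have up: "?D * (?D - 1) \<le> d * card A" by simp
    have r: "?r * ?r = card A" by (simp flip: powr_add)
    have d: "1 \<le> real d" using H by simp
    have r0: "0 \<le> ?r" by simp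
    \<comment> \<open>The assumption on \<open>?D\<close> is used twice: with \<open>d\<close> at
      least 1 it gives both \<open>?D - 1 > ?r\<close> and \<open>?D > ?r * d\<close>, and the
      product of the two exceeds \<open>d * card A\<close>.\<close>
    then have "(?r + 1) * 1 \<le> (?r + 1) * d" using d by (intro mult_left_mono) auto
    from le_less_trans[OF this gt] have "?r < ?D - 1" by simp
    moreover have "?r * d < ?D" using gt d by (simp add: distrib_right)
    ultimately have "(?r * d) * ?r < ?D * (?D - 1)" using r0 by (intro mult_strict_mono') auto
    moreover have "(?r * d) * ?r = d * (?r * ?r)" by (simp only: mult_ac)
    then have "(?r * d) * ?r = d * card A" unfolding r by simp
    ultimately show False using up by linarith
  qed
  moreover have "assignment X ((\<lambda>a. (a, s a)) ` A) s" using XA by (auto simp: assignment_def)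
  ultimately show "\<exists>g. assignment X ((\<lambda>a. (a, s a)) ` A) g \<and> (\<forall>b. real (load X g b) \<le> (?r + 1) * d)"
    by blast
qed

lemma skeleton_mono: "skeleton E T \<gamma> \<Longrightarrow> \<gamma> \<le> \<gamma>' \<Longrightarrow> skeleton E T \<gamma>'"
  unfolding skeleton_def by (meson mult_right_mono of_nat_0_le_iff order_trans)

text \<open>To be applied to a Hall violator \<open>X\<close> whose neighbourhood is
  \<open>Y\<close>. The hypothesis \<open>2 \<le> \<mu>\<close> absorbs the lower-order terms caused
  by the \<open>- 1\<close> in \<open>balanced_expansion\<close>.\<close>

lemma two_level_count:
  fixes \<mu> :: real
  assumes "finite A" "balanced A E s" "\<And>b. balanced {a \<in> A. s a = b} E t"
    and "X \<subseteq> A" "assignment X E f" "\<And>b. load X f b \<le> d" "1 \<le> d"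
    and "finite Y" "s ` X \<subseteq> Y" "t ` X \<subseteq> Y"
    and "real (card X) = \<mu> * card Y" "2 \<le> \<mu>" "0 < card Y"
  shows "\<mu> ^ 3 \<le> 4 * (real d)\<^sup>2 * card A"
proof -
  define n where "n = real (card A)"
  define k where "k = real (card Y)"
  define D where "D b = real (load X s b)" for b
  define \<sigma> where "\<sigma> b = real (load A s b)" for b
  have fX: "finite X" using assms(1,4) finite_subset by blast
  have k: "k > 0" using assms(13) by (simp add: k_def)
  have d: "1 \<le> real d" using assms(7) by simp
  have D0: "0 \<le> D b" for b by (simp add: D_def)
  have D\<sigma>: "D b \<le> \<sigma> b" for b using load_mono[OF assms(1,4)] by (simp add: D_def \<sigma>_def)
  have sumD: "(\<Sum>b\<in>Y. D b) = \<mu> * k"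
    using sum_load_eq_card[OF fX assms(8,9)] assms(11) by (simp add: D_def k_def flip: of_nat_sum)
  have "(\<Sum>b\<in>Y. D b * (\<sigma> b - 1)) \<le> d * n"
    using balanced_expansion[OF assms(1,2,4,5,6)]
    by (simp add: D_def \<sigma>_def n_def sum_by_load[OF fX assms(8,9), where h = "\<lambda>b. real (load A s b) - 1"])
  then have D_\<sigma>: "(\<Sum>b\<in>Y. D b * \<sigma> b) \<le> d * n + \<mu> * k"
    by (simp add: right_diff_distrib sum_subtractf sumD)
  have "(\<Sum>b\<in>Y. (D b)\<^sup>2) \<le> (\<Sum>b\<in>Y. D b * \<sigma> b)"
    unfolding power2_eq_square by (intro sum_mono mult_left_mono D\<sigma> D0)
  then have D2: "(\<Sum>b\<in>Y. (D b)\<^sup>2) \<le> d * n + \<mu> * k" using D_\<sigma> by simp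
  \<comment> \<open>Expansion for \<open>t\<close> inside the fibre of \<open>b\<close>: the
    \<open>D b\<close> vertices are spread over the \<open>k\<close> elements of \<open>Y\<close>,
    so their squared loads sum to at least \<open>(D b)\<^sup>2 / k\<close>.\<close>
  have fiber: "(D b)\<^sup>2 / k - D b \<le> d * \<sigma> b" for b
  proof -
    let ?A = "{a \<in> A. s a = b}" and ?X = "{a \<in> X. s a = b}"
    define p where "p c = real (load ?X t c)" for c
    have fA': "finite ?A" and fX': "finite ?X" using assms(1) fX by auto
    have tY: "t ` ?X \<subseteq> Y" using assms(10) by auto
    have "real (card ?X) = D b" by (simp add: D_def load_def)
    then have sump: "(\<Sum>c\<in>Y. p c) = D b"
      using sum_load_eq_card[OF fX' assms(8) tY] by (simp add: p_def flip: of_nat_sum)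
    have "(D b / k)\<^sup>2 * k \<le> (\<Sum>c\<in>Y. (p c)\<^sup>2)"
      unfolding k_def using assms(13) by (intro sum_squares_ge assms(8)) (simp add: sump)
    then have "(D b)\<^sup>2 / k - D b \<le> (\<Sum>c\<in>Y. p c * (p c - 1))"
      using k by (simp add: power2_eq_square right_diff_distrib sum_subtractf sump)
    also have "\<dots> = (\<Sum>a\<in>?X. p (t a) - 1)"
      by (simp add: p_def sum_by_load[OF fX' assms(8) tY, where h = "\<lambda>c. real (load ?X t c) - 1"])
    also have "\<dots> \<le> (\<Sum>a\<in>?X. real (load ?A t (t a)) - 1)"
    proof (rule sum_mono)
      fix a
      have "load ?X t (t a) \<le> load ?A t (t a)" using assms(4) by (intro load_mono fA') auto
      then show "p (t a) - 1 \<le> real (load ?A t (t a)) - 1" by (simp add: p_def)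
    qed
    also have "\<dots> \<le> real d * real (card ?A)"
    proof (rule balanced_expansion[OF fA' assms(3)])
      show "assignment ?X E f" using assms(5) by (simp add: assignment_def)
      show "load ?X f c \<le> d" for c
        using load_mono[OF fX, of ?X f c] assms(6)[of c] by auto
    qed (use assms(4) in auto)
    finally show ?thesis by (simp add: \<sigma>_def load_def)
  qed
  have "\<mu>\<^sup>2 * k \<le> (\<Sum>b\<in>Y. (D b)\<^sup>2)"
    unfolding k_def by (intro sum_squares_ge assms(8)) (simp add: sumD k_def)
  then have "\<mu> * (\<mu> * k) \<le> d * n + \<mu> * k" using D2 by (simp add: power2_eq_square)
  \<comment> \<open>By \<open>2 \<le> \<mu>\<close> the term \<open>\<mu> * k\<close> is at most
    half of the left side, hence at most \<open>d * n\<close>.\<close>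
  moreover have "2 * (\<mu> * k) \<le> \<mu> * (\<mu> * k)" using assms(12) k by (intro mult_right_mono) auto
  ultimately have x: "\<mu> * k \<le> d * n" by simp
  have "\<mu> ^ 3 * k \<le> (\<Sum>b\<in>Y. D b ^ 3)"
    unfolding k_def using assms(12)
    by (intro sum_cubes_ge assms(8) D0) (auto simp: sumD k_def)
  \<comment> \<open>Multiplying the fibre bound by \<open>D b\<close> makes
    \<open>\<sigma> b\<close> enter only through \<open>D b * \<sigma> b\<close>, whose sum is
    controlled by the expansion of \<open>s\<close>.\<close>
  moreover have "D b ^ 3 \<le> k * (d * (D b * \<sigma> b) + (D b)\<^sup>2)" for b
  proof -
    have "(D b)\<^sup>2 \<le> k * (d * \<sigma> b + D b)" using fiber[of b] k by (simp add: field_simps)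
    then have "D b * (D b)\<^sup>2 \<le> D b * (k * (d * \<sigma> b + D b))" by (intro mult_left_mono D0)
    then show ?thesis by (simp add: power2_eq_square power3_eq_cube algebra_simps)
  qed
  then have "(\<Sum>b\<in>Y. D b ^ 3) \<le> (\<Sum>b\<in>Y. k * (d * (D b * \<sigma> b) + (D b)\<^sup>2))" by (rule sum_mono)
  moreover have "\<dots> = k * (d * (\<Sum>b\<in>Y. D b * \<sigma> b) + (\<Sum>b\<in>Y. (D b)\<^sup>2))"
    by (simp only: sum.distrib sum_distrib_left[symmetric])
  moreover have "\<dots> \<le> k * (d * (d * n + \<mu> * k) + (d * n + \<mu> * k))"
    using k by (intro mult_left_mono add_mono D_\<sigma> D2) auto
  ultimately have "k * \<mu> ^ 3 \<le> k * (d * (d * n + \<mu> * k) + (d * n + \<mu> * k))"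
    by (simp add: mult.commute)
  then have "\<mu> ^ 3 \<le> d * (d * n + \<mu> * k) + (d * n + \<mu> * k)" using k by simp
  \<comment> \<open>Each bracket is at most \<open>2 * (d * n)\<close>. The second one gains a
    factor \<open>d\<close>, which is at least 1, and this yields the constant 4.\<close>
  also have "\<dots> \<le> d * (2 * (d * n)) + d * (2 * (d * n))"
  proof (rule add_mono)
    show "d * (d * n + \<mu> * k) \<le> d * (2 * (d * n))" using x by (intro mult_left_mono) (simp_all add: mult.commute)
    have "0 \<le> 2 * (d * n)" by (simp add: n_def)
    then have "1 * (2 * (d * n)) \<le> d * (2 * (d * n))" using d by (intro mult_right_mono) auto
    then show "d * n + \<mu> * k \<le> d * (2 * (d * n))" using x by simp
  qed
  finally show ?thesis by (simp add: n_def power2_eq_square)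
qed

lemma two_level_skeleton:
  assumes "finite A" "E \<subseteq> A \<times> B" "balanced A E s" "\<And>b. balanced {a \<in> A. s a = b} E t"
  shows "skeleton E ((\<lambda>a. (a, s a)) ` A \<union> (\<lambda>a. (a, t a)) ` A) (2 * real (card A) powr (1/3) + 1)"
    (is "skeleton E ?T _")
  unfolding skeleton_def
proof (intro conjI allI impI)
  show "?T \<subseteq> E" using assms(3,4) by (auto simp: balanced_def assignment_def)
next
  fix X :: "'a set" and f d
  assume H: "finite X \<and> assignment X E f \<and> 1 \<le> d \<and> (\<forall>b. load X f b \<le> d)"
  define r where "r = real (card A) powr (1/3)"
  have r0: "0 \<le> r" by (simp add: r_def)
  \<comment> \<open>Rounding up costs at most 1, which \<open>d\<close> absorbs into the
    \<open>+ 1\<close> of the factor.\<close>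
  define \<Delta> where "\<Delta> = nat \<lceil>2 * r * d\<rceil>"
  have \<Delta>: "2 * r * d \<le> \<Delta>" "\<Delta> \<le> 2 * r * d + 1" using r0 by (auto simp: \<Delta>_def)
  have XA: "X \<subseteq> A" using H assms(2) by (auto simp: assignment_def)
  have d: "1 \<le> real d" using H by simp
  have "card Z \<le> \<Delta> * card (\<Union>((\<lambda>a. {s a, t a}) ` Z))" if Z: "Z \<subseteq> X" for Z
  proof (rule ccontr)
    let ?Y = "\<Union>((\<lambda>a. {s a, t a}) ` Z)"
    assume "\<not> card Z \<le> \<Delta> * card ?Y"
    then have big: "real (\<Delta> * card ?Y) < real (card Z)" by (simp only: of_nat_less_iff not_le)
    have fZ: "finite Z" using Z H finite_subset by blast
    have "Z \<noteq> {}" using big by auto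
    then have Y: "finite ?Y" "0 < card ?Y" using fZ by (auto simp: card_gt_0_iff)
    have n1: "1 \<le> real (card A)"
    proof -
      have "A \<noteq> {}" using \<open>Z \<noteq> {}\<close> Z XA by auto
      then show ?thesis using assms(1) by (simp add: Suc_leI card_gt_0_iff)
    qed
    then have r1: "1 \<le> r" by (simp add: r_def ge_one_powr_ge_zero)
    define \<mu> where "\<mu> = real (card Z) / card ?Y"
    have "real \<Delta> < \<mu>" using big Y(2) by (simp add: \<mu>_def pos_less_divide_eq)
    then have \<mu>: "2 * r * d < \<mu>" using \<Delta>(1) by linarith
    \<comment> \<open>The factor 2 in \<open>\<Delta>\<close> serves twice:
      \<open>1 \<le> r * d\<close> gives \<open>2 \<le> \<mu>\<close>, and its cube 8 exceeds the 4
      of \<open>two_level_count\<close>.\<close>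
    have rd: "1 \<le> r * d" using mult_mono[OF r1 d] r0 by simp
    have "\<mu> ^ 3 \<le> 4 * (real d)\<^sup>2 * card A"
    proof (rule two_level_count[OF assms(1,3,4), where X = Z and f = f and Y = ?Y])
      show "assignment Z E f" using H Z by (auto simp: assignment_def)
      show "load Z f b \<le> d" for b using H load_mono[of X Z f b] Z by (meson order_trans)
      show "real (card Z) = \<mu> * card ?Y" using Y by (simp add: \<mu>_def)
    qed (use H Z XA Y \<mu> rd in auto)
    moreover have "(2 * r * d) ^ 3 < \<mu> ^ 3" using \<mu> r0 by (intro power_strict_mono) auto
    moreover have r3: "r ^ 3 = card A" using n1 by (simp add: r_def powr_power)
    moreover have "(2 * r * d) ^ 3 = 8 * (card A * (real d ^ 2 * d))"
      unfolding r3[symmetric] by (simp add: power_mult_distrib power2_eq_square power3_eq_cube)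
    moreover have "card A * (real d ^ 2 * 1) \<le> card A * (real d ^ 2 * d)"
      using d by (intro mult_left_mono) auto
    moreover have "0 \<le> card A * (real d ^ 2 * 1)" by simp
    moreover have "4 * (real d)\<^sup>2 * card A = 4 * (card A * (real d ^ 2 * 1))" by simp
    ultimately show False by linarith
  qed
  then obtain g where g: "\<forall>a\<in>X. g a \<in> {s a, t a}" "\<forall>b. load X g b \<le> \<Delta>"
    using Hall_capacity[of X "\<lambda>a. {s a, t a}" \<Delta>] H by auto
  have "assignment X ?T g" using g(1) XA by (fastforce simp: assignment_def)
  moreover have "real (load X g b) \<le> (2 * r + 1) * d" for b
  proof -
    have "real (load X g b) \<le> \<Delta>" using g(2) by simp
    then show ?thesis using \<Delta>(2) d by (simp add: algebra_simps)
  qed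
  ultimately show "\<exists>g. assignment X ?T g \<and>
      (\<forall>b. real (load X g b) \<le> (2 * real (card A) powr (1/3) + 1) * d)"
    unfolding r_def by blast
qed

section \<open>Assignments and semi-matchings\<close>

lemma deg_graph_fst:
  assumes "S \<subseteq> A \<times> B" "A \<inter> B = {}" "a \<in> A"
  shows "deg S a = card {b. (a, b) \<in> S}"
proof -
  have "{e \<in> S. fst e = a \<or> snd e = a} = Pair a ` {b. (a, b) \<in> S}" using assms by auto
  then show ?thesis by (simp add: deg_def card_image inj_on_def)
qed

lemma deg_graph_snd:
  assumes "S \<subseteq> A \<times> B" "A \<inter> B = {}" "b \<in> B"
  shows "deg S b = card {a. (a, b) \<in> S}"
proof -
  have "{e \<in> S. fst e = b \<or> snd e = b} = (\<lambda>a. (a, b)) ` {a. (a, b) \<in> S}" using assms by auto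
  then show ?thesis by (simp add: deg_def card_image inj_on_def)
qed

text \<open>This makes the maximum degree an admissible \<open>d\<close> for
  \<open>skeleton\<close>; any vertex of \<open>A\<close> shows that it is at least 1.\<close>

lemma semi_matching_assignment:
  assumes "finite A" "finite B" "A \<inter> B = {}" "E \<subseteq> A \<times> B" "semi_matching A E S" "A \<noteq> {}"
  obtains f where "assignment A E f" "\<And>b. load A f b \<le> deg_max A B S" "1 \<le> deg_max A B S"
proof -
  have S: "S \<subseteq> A \<times> B" using assms(4,5) by (auto simp: semi_matching_def)
  have "\<exists>b. (a, b) \<in> S" if "a \<in> A" for a
  proof -
    have "card {b. (a, b) \<in> S} = 1"
      using assms(5) that deg_graph_fst[OF S assms(3)] by (simp add: semi_matching_def)
    then show ?thesis by (metis card_1_singletonE mem_Collect_eq singletonI)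
  qed
  then obtain f where f: "\<And>a. a \<in> A \<Longrightarrow> (a, f a) \<in> S" by metis
  have le: "deg S v \<le> deg_max A B S" if "v \<in> A \<union> B" for v
    unfolding deg_max_def using assms(1,2) that by (intro Max_ge) auto
  have "load A f b \<le> deg_max A B S" for b
  proof (cases "b \<in> B")
    case True
    have "finite {a. (a, b) \<in> S}" by (rule finite_subset[OF _ assms(1)]) (use S in auto)
    then have "load A f b \<le> deg S b"
      unfolding load_def deg_graph_snd[OF S assms(3) True] using f by (intro card_mono) auto
    then show ?thesis using le[of b] True by simp
  next
    case False
    then have "{a \<in> A. f a = b} = {}" using f S by auto
    then show ?thesis unfolding load_def by (simp only: card.empty)
  qed
  moreover obtain a where "a \<in> A" using assms(6) by blast
  then have "1 \<le> deg_max A B S" using le[of a] assms(5) by (simp add: semi_matching_def)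
  moreover have "assignment A E f" using f assms(5) by (auto simp: assignment_def semi_matching_def)
  ultimately show thesis using that by blast
qed

text \<open>The premise \<open>1 \<le> \<delta>\<close> covers the vertices of \<open>A\<close>,
  over which \<open>deg_max\<close> ranges too.\<close>

lemma assignment_semi_matching:
  assumes "finite A" "finite B" "A \<inter> B = {}" "E \<subseteq> A \<times> B" "assignment A E g" "A \<noteq> {}"
    and "\<And>b. real (load A g b) \<le> \<delta>" "1 \<le> \<delta>"
  shows "\<exists>S. semi_matching A E S \<and> real (deg_max A B S) \<le> \<delta>"
proof -
  define S where "S = (\<lambda>a. (a, g a)) ` A"
  have SE: "S \<subseteq> E" using assms(5) by (auto simp: S_def assignment_def)
  then have S: "S \<subseteq> A \<times> B" using assms(4) by blast
  have A: "deg S a = 1" if "a \<in> A" for a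
  proof -
    have "{b. (a, b) \<in> S} = {g a}" using that by (auto simp: S_def)
    then show ?thesis using deg_graph_fst[OF S assms(3) that] by simp
  qed
  have "real (deg S v) \<le> \<delta>" if "v \<in> A \<union> B" for v
  proof (cases "v \<in> A")
    case True
    then show ?thesis using A assms(8) by simp
  next
    case False
    have "{a. (a, v) \<in> S} = {a \<in> A. g a = v}" by (auto simp: S_def)
    then show ?thesis using False that deg_graph_snd[OF S assms(3)] assms(7)[of v] by (simp add: load_def)
  qed
  moreover have "deg_max A B S \<in> deg S ` (A \<union> B)"
    unfolding deg_max_def using assms(1,2,6) by (intro Max_in) auto
  ultimately have "real (deg_max A B S) \<le> \<delta>" by auto
  then show ?thesis using SE A by (auto simp: semi_matching_def)
qed

section \<open>Protocols from skeletons\<close>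

lemma skeleton_semi_matching:
  assumes "finite A" "finite B" "A \<inter> B = {}" "E\<^sub>1 \<union> E\<^sub>2 \<subseteq> A \<times> B" "A \<noteq> {}"
    and "skeleton E\<^sub>1 T \<gamma>" "0 \<le> \<gamma>" "semi_matching A (E\<^sub>1 \<union> E\<^sub>2) S'"
  shows "\<exists>S. semi_matching A (T \<union> E\<^sub>2) S \<and> real (deg_max A B S) \<le> (\<gamma> + 1) * deg_max A B S'"
proof -
  let ?d = "deg_max A B S'"
  obtain f where f: "assignment A (E\<^sub>1 \<union> E\<^sub>2) f" "\<And>b. load A f b \<le> ?d" and d: "1 \<le> ?d"
    using semi_matching_assignment[OF assms(1-4,8,5)] by blast
  define X where "X = {a \<in> A. (a, f a) \<in> E\<^sub>1}"
  have XA: "X \<subseteq> A" by (auto simp: X_def)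
  have "assignment X E\<^sub>1 f" by (auto simp: assignment_def X_def)
  moreover have "load X f b \<le> ?d" for b using load_mono[OF assms(1) XA] f(2) le_trans by blast
  moreover have "finite X" using XA assms(1) finite_subset by blast
  ultimately obtain g where g: "assignment X T g" "\<And>b. real (load X g b) \<le> \<gamma> * ?d"
    using assms(6) d unfolding skeleton_def by blast
  define h where "h a = (if a \<in> X then g a else f a)" for a
  have h: "assignment A (T \<union> E\<^sub>2) h"
    using f(1) g(1) by (auto simp: h_def assignment_def X_def)
  have "real (load A h b) \<le> (\<gamma> + 1) * ?d" for b
  proof -
    \<comment> \<open>A vertex sent to \<open>b\<close> is either rerouted by \<open>g\<close> or
      keeps its value under \<open>f\<close>; the second kind causes the \<open>+ 1\<close> in the
      factor.\<close>
    have "load A h b \<le> card ({a \<in> X. g a = b} \<union> {a \<in> A. f a = b})"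
      unfolding load_def using assms(1) XA \<open>finite X\<close> by (intro card_mono) (auto simp: h_def)
    also have "\<dots> \<le> load X g b + load A f b" unfolding load_def by (rule card_Un_le)
    finally have "real (load A h b) \<le> real (load X g b) + real (load A f b)" by linarith
    moreover have "real (load A f b) \<le> ?d" using f(2) by simp
    ultimately show ?thesis using g(2)[of b] by (simp add: distrib_right)
  qed
  moreover have "T \<union> E\<^sub>2 \<subseteq> A \<times> B" using assms(4,6) by (auto simp: skeleton_def)
  moreover have "1 \<le> (\<gamma> + 1) * ?d"
    using mult_mono[of 1 "\<gamma> + 1" 1 "real ?d"] d assms(7) by simp
  ultimately show ?thesis using assignment_semi_matching[OF assms(1-3) _ h assms(5)] by blast
qed

text \<open>\<open>K\<close> collects the candidate sparse graphs, and the message names one of them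
  in \<open>l\<close> bits. Bob minimizes the maximum degree over the semi-matchings of
  \<open>T \<union> E\<^sub>2\<close>, so he can do without knowing the one he is compared
  with.\<close>

lemma skeleton_protocol:
  fixes K :: "'v edges set"
  assumes "finite A" "finite B" "A \<inter> B = {}" "A \<noteq> {}" "0 \<le> \<gamma>"
    and K: "finite K" "card K \<le> 2 ^ l" "real l \<le> L"
    and sk: "\<And>E. E \<subseteq> A \<times> B \<Longrightarrow> \<exists>T\<in>K. skeleton E T \<gamma>"
  shows "\<exists>alice bob. semi_matching_protocol A B alice bob L (\<gamma> + 1)"
proof -
  have "finite {xs :: bool list. length xs = l}" "card {xs :: bool list. length xs = l} = 2 ^ l"
    using finite_lists_length_eq[of "UNIV :: bool set" l] card_lists_length_eq[of "UNIV :: bool set" l]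
    by simp_all
  then obtain enc :: "'v edges \<Rightarrow> bool list" where enc: "enc ` K \<subseteq> {xs. length xs = l}" "inj_on enc K"
    using card_le_inj[OF K(1), of "{xs :: bool list. length xs = l}"] K(2) by auto
  obtain skel where skel: "\<And>E. E \<subseteq> A \<times> B \<Longrightarrow> skel E \<in> K \<and> skeleton E (skel E) \<gamma>"
    using sk by metis
  define bob where "bob msg E\<^sub>2 = arg_min (deg_max A B) (semi_matching A (inv_into K enc msg \<union> E\<^sub>2))"
    for msg E\<^sub>2
  have "semi_matching_protocol A B (enc \<circ> skel) bob L (\<gamma> + 1)"
    unfolding semi_matching_protocol_def
  proof (intro allI impI)
    fix E\<^sub>1 E\<^sub>2
    assume H: "bipartite_graph A B (E\<^sub>1 \<union> E\<^sub>2) \<and> E\<^sub>1 \<inter> E\<^sub>2 = {} \<and> (\<exists>S. semi_matching A (E\<^sub>1 \<union> E\<^sub>2) S)"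
    then have E: "E\<^sub>1 \<union> E\<^sub>2 \<subseteq> A \<times> B" by (simp add: bipartite_graph_def)
    let ?T = "skel E\<^sub>1" and ?S = "bob (enc (skel E\<^sub>1)) E\<^sub>2"
    have T: "?T \<in> K" "skeleton E\<^sub>1 ?T \<gamma>" using skel[of E\<^sub>1] E by auto
    have S: "?S = arg_min (deg_max A B) (semi_matching A (?T \<union> E\<^sub>2))"
      using enc(2) T(1) by (simp add: bob_def)
    have ex: "\<exists>S. semi_matching A (?T \<union> E\<^sub>2) S \<and> real (deg_max A B S) \<le> (\<gamma> + 1) * deg_max A B S'"
      if "semi_matching A (E\<^sub>1 \<union> E\<^sub>2) S'" for S'
      by (rule skeleton_semi_matching[OF assms(1-3) E assms(4) T(2) assms(5) that])
    \<comment> \<open>The promised semi-matching of the whole graph yields one of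
      \<open>?T \<union> E\<^sub>2\<close>, so \<open>arg_min\<close> ranges over a nonempty
      set.\<close>
    then obtain S\<^sub>0 where "semi_matching A (?T \<union> E\<^sub>2) S\<^sub>0" using H by blast
    then have sm: "semi_matching A (?T \<union> E\<^sub>2) ?S"
      and min: "\<And>S. semi_matching A (?T \<union> E\<^sub>2) S \<Longrightarrow> deg_max A B ?S \<le> deg_max A B S"
      unfolding S using arg_min_nat_lemma by metis+
    have "real (deg_max A B ?S) \<le> (\<gamma> + 1) * deg_max A B S'"
      if "optimal_semi_matching A (E\<^sub>1 \<union> E\<^sub>2) S'" for S'
    proof -
      have "semi_matching A (E\<^sub>1 \<union> E\<^sub>2) S'" using that by (simp add: optimal_semi_matching_def)
      from ex[OF this] obtain S where
        "semi_matching A (?T \<union> E\<^sub>2) S" "real (deg_max A B S) \<le> (\<gamma> + 1) * deg_max A B S'" by blast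
      moreover from this(1) have "real (deg_max A B ?S) \<le> real (deg_max A B S)" using min by simp
      ultimately show ?thesis by linarith
    qed
    moreover have "semi_matching A (E\<^sub>1 \<union> E\<^sub>2) ?S"
      using sm T(2) by (auto simp: semi_matching_def skeleton_def)
    moreover have "length (enc ?T) = l" using enc(1) T(1) by auto
    ultimately show "real (length ((enc \<circ> skel) E\<^sub>1)) \<le> L \<and>
        semi_matching A (E\<^sub>1 \<union> E\<^sub>2) (bob ((enc \<circ> skel) E\<^sub>1) E\<^sub>2) \<and>
        (\<forall>S'. optimal_semi_matching A (E\<^sub>1 \<union> E\<^sub>2) S' \<longrightarrow>
           real (deg_max A B (bob ((enc \<circ> skel) E\<^sub>1) E\<^sub>2)) \<le> (\<gamma> + 1) * real (deg_max A B S'))"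
      using K(3) by simp
  qed
  then show ?thesis by blast
qed

text \<open>In these cases the message budget of the theorem is 0. The empty message suffices
  because \<open>A \<times> B\<close> is the only possible semi-matching.\<close>

lemma trivial_protocol:
  assumes "finite A" "finite B" "A \<inter> B = {}" "A = {} \<or> card B \<le> 1" "0 \<le> L" "1 \<le> \<beta>"
  shows "\<exists>alice bob. semi_matching_protocol A B alice bob L \<beta>"
proof -
  have uniq: "S = A \<times> B" if sm: "semi_matching A E S" "E \<subseteq> A \<times> B" for E S
  proof (cases "A = {}")
    case True
    then show ?thesis using that by (auto simp: semi_matching_def)
  next
    case False
    \<comment> \<open>Taking \<open>S\<close> as its own ambient graph places the assignment in
      \<open>S\<close> itself.\<close>
    obtain f where "assignment A S f"
    proof (rule semi_matching_assignment[OF assms(1-3) _ _ False])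
      show "S \<subseteq> A \<times> B" using sm by (auto simp: semi_matching_def)
      show "semi_matching A S S" using sm by (auto simp: semi_matching_def)
    qed
    then have f: "\<And>a. a \<in> A \<Longrightarrow> (a, f a) \<in> S" by (simp add: assignment_def)
    moreover have "b = b'" if "b \<in> B" "b' \<in> B" for b b'
      using that assms(2,4) False by (metis One_nat_def card_le_Suc0_iff_eq)
    moreover have "S \<subseteq> A \<times> B" using sm by (auto simp: semi_matching_def)
    ultimately show ?thesis by blast
  qed
  have "semi_matching_protocol A B (\<lambda>_. []) (\<lambda>_ _. A \<times> B) L \<beta>"
    unfolding semi_matching_protocol_def
  proof (intro allI impI)
    fix E\<^sub>1 E\<^sub>2
    assume H: "bipartite_graph A B (E\<^sub>1 \<union> E\<^sub>2) \<and> E\<^sub>1 \<inter> E\<^sub>2 = {} \<and> (\<exists>S. semi_matching A (E\<^sub>1 \<union> E\<^sub>2) S)"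
    then have E: "E\<^sub>1 \<union> E\<^sub>2 \<subseteq> A \<times> B" by (simp add: bipartite_graph_def)
    have "real (deg_max A B (A \<times> B)) \<le> \<beta> * deg_max A B S'"
      if "optimal_semi_matching A (E\<^sub>1 \<union> E\<^sub>2) S'" for S'
    proof -
      have "S' = A \<times> B" using that uniq[OF _ E] by (simp only: optimal_semi_matching_def)
      then show ?thesis using mult_right_mono[OF assms(6), of "real (deg_max A B S')"] by simp
    qed
    moreover have "semi_matching A (E\<^sub>1 \<union> E\<^sub>2) (A \<times> B)" using H uniq[OF _ E] by metis
    ultimately show "real (length ([] :: bool list)) \<le> L \<and> semi_matching A (E\<^sub>1 \<union> E\<^sub>2) (A \<times> B) \<and>
        (\<forall>S'. optimal_semi_matching A (E\<^sub>1 \<union> E\<^sub>2) S' \<longrightarrow>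
           real (deg_max A B (A \<times> B)) \<le> \<beta> * real (deg_max A B S'))"
      using assms(5) by simp
  qed
  then show ?thesis by blast
qed

section \<open>Counting the messages\<close>

text \<open>The value \<open>None\<close> stands for the vertices of \<open>A\<close> without an edge in \<open>E\<^sub>1\<close>.\<close>

definition partial_graphs :: "'v set \<Rightarrow> 'v set \<Rightarrow> 'v edges set" where
  "partial_graphs A B =
     (\<lambda>h. {(a, b). a \<in> A \<and> h a = Some b}) ` (A \<rightarrow>\<^sub>E insert None (Some ` B))"

lemma partial_graphs_card:
  assumes "finite A" "finite B"
  shows "finite (partial_graphs A B)" "card (partial_graphs A B) \<le> Suc (card B) ^ card A"
proof -
  have "card (insert None (Some ` B)) = Suc (card B)" using assms(2) by (simp add: card_image)
  then have "card (A \<rightarrow>\<^sub>E insert None (Some ` B)) = Suc (card B) ^ card A"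
    using assms(1) by (simp add: card_PiE)
  moreover have "finite (A \<rightarrow>\<^sub>E insert None (Some ` B))" using assms by (intro finite_PiE) auto
  ultimately show "finite (partial_graphs A B)" "card (partial_graphs A B) \<le> Suc (card B) ^ card A"
    unfolding partial_graphs_def by (auto intro: card_image_le[THEN order_trans])
qed

lemma graph_in_partial_graphs:
  assumes "V \<subseteq> A" "s ` V \<subseteq> B"
  shows "(\<lambda>a. (a, s a)) ` V \<in> partial_graphs A B"
  unfolding partial_graphs_def
proof (rule image_eqI)
  let ?h = "\<lambda>a\<in>A. if a \<in> V then Some (s a) else None"
  show "?h \<in> A \<rightarrow>\<^sub>E insert None (Some ` B)" using assms by (auto simp: image_subset_iff)
  show "(\<lambda>a. (a, s a)) ` V = {(a, b). a \<in> A \<and> ?h a = Some b}"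
    using assms by (auto split: if_splits)
qed

text \<open>The message names \<open>j\<close> partial graphs. For \<open>2 \<le> m\<close> one has
  \<open>Suc m \<le> m ^ 2\<close>, so \<open>2 * (j * n * log 2 m)\<close> bits suffice before
  rounding, and rounding adds at most 1, which is at most \<open>j * n * log 2 m\<close>. The
  resulting 3 becomes the constant \<open>c\<close>.\<close>

lemma message_length:
  fixes n m j :: nat
  assumes "1 \<le> n" "2 \<le> m" "1 \<le> j"
  shows "\<exists>l. (Suc m ^ n) ^ j \<le> 2 ^ l \<and> real l \<le> 3 * (real j * real n * log 2 (real m))"
proof -
  define x where "x = real j * real n * log 2 (real m)"
  define l where "l = nat \<lceil>2 * x\<rceil>"
  have lm: "1 \<le> log 2 (real m)" using assms(2) by simp
  have "1 \<le> j * n" using assms(1,3) by simp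
  then have "1 \<le> real (j * n)" by (simp only: of_nat_1 flip: of_nat_le_iff)
  then have "1 * 1 \<le> real (j * n) * log 2 (real m)" using lm by (intro mult_mono) auto
  then have x: "1 \<le> x" by (simp add: x_def)
  have "Suc m \<le> 2 * m" using assms(2) by simp
  also have "\<dots> \<le> m ^ 2" using assms(2) by (simp add: power2_eq_square)
  finally have "(Suc m ^ n) ^ j \<le> ((m ^ 2) ^ n) ^ j" by (intro power_mono) auto
  then have "real ((Suc m ^ n) ^ j) \<le> real (((m ^ 2) ^ n) ^ j)" by (simp only: of_nat_le_iff)
  also have "\<dots> = real m ^ (2 * n * j)" by (simp add: power_mult)
  also have "\<dots> = real m powr real (2 * n * j)" using assms(2) by (intro powr_realpow[symmetric]) simp
  also have "\<dots> = (2 powr log 2 (real m)) powr real (2 * n * j)" using assms(2) by simp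
  also have "\<dots> = 2 powr (2 * x)" by (simp only: powr_powr) (simp add: x_def mult_ac)
  also have "\<dots> \<le> 2 powr l" unfolding l_def by (intro powr_mono) linarith+
  also have "\<dots> = real (2 ^ l)" by (simp add: powr_realpow)
  finally have "(Suc m ^ n) ^ j \<le> 2 ^ l" by (simp only: of_nat_le_iff)
  moreover have "real l \<le> 3 * x" using x unfolding l_def by linarith
  ultimately show ?thesis unfolding x_def by blast
qed

section \<open>The two protocols\<close>

lemma sqrt_protocol:
  assumes "finite A" "finite B" "A \<inter> B = {}" "A \<noteq> {}" "2 \<le> card B"
  shows "\<exists>alice bob. semi_matching_protocol A B alice bob
    (3 * real (card A) * log 2 (real (card B))) (real (card A) powr (1/2) + 2)"
proof -
  have "1 \<le> card A" using assms(1,4) by (simp add: Suc_leI card_gt_0_iff)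
  from message_length[OF this assms(5), of 1] obtain l where
    l: "Suc (card B) ^ card A \<le> 2 ^ l" "real l \<le> 3 * real (card A) * log 2 (real (card B))" by auto
  have "\<exists>alice bob. semi_matching_protocol A B alice bob
      (3 * real (card A) * log 2 (real (card B))) ((real (card A) powr (1/2) + 1) + 1)"
  proof (rule skeleton_protocol[OF assms(1-4)])
    show "finite (partial_graphs A B)" "card (partial_graphs A B) \<le> 2 ^ l"
      using partial_graphs_card[OF assms(1,2)] l(1) by auto
    show "\<exists>T\<in>partial_graphs A B. skeleton E T (real (card A) powr (1/2) + 1)"
      if E: "E \<subseteq> A \<times> B" for E
    proof -
      \<comment> \<open>Only vertices with an edge in \<open>E\<close> can be assigned, so the
        construction runs on \<open>?V\<close>; \<open>skeleton_mono\<close> then passes from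
        \<open>card ?V\<close> to \<open>card A\<close>.\<close>
      let ?V = "fst ` E"
      have V: "?V \<subseteq> A" "E \<subseteq> ?V \<times> B" using E by force+
      then have fV: "finite ?V" using assms(1) finite_subset by blast
      obtain s where s: "balanced ?V E s"
        using balanced_exists[OF fV assms(2), of E] E by force
      have "s ` ?V \<subseteq> B" using s E by (auto simp: balanced_def assignment_def)
      then have "(\<lambda>a. (a, s a)) ` ?V \<in> partial_graphs A B" by (rule graph_in_partial_graphs[OF V(1)])
      moreover have "real (card ?V) powr (1/2) + 1 \<le> real (card A) powr (1/2) + 1"
        using card_mono[OF assms(1) V(1)] by (auto intro: powr_mono2)
      ultimately show ?thesis using skeleton_mono[OF balanced_skeleton[OF fV s V(2)]] by blast
    qed
  qed (use l in auto)
  then show ?thesis by (simp add: add.assoc)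
qed

lemma cbrt_protocol:
  assumes "finite A" "finite B" "A \<inter> B = {}" "A \<noteq> {}" "2 \<le> card B"
  shows "\<exists>alice bob. semi_matching_protocol A B alice bob
    (6 * real (card A) * log 2 (real (card B))) (2 * real (card A) powr (1/3) + 2)"
proof -
  let ?P = "partial_graphs A B"
  \<comment> \<open>The message names a union of two partial graphs, which doubles its
    length.\<close>
  let ?K = "(\<lambda>(T, U). T \<union> U) ` (?P \<times> ?P)"
  have P: "finite ?P" "card ?P \<le> Suc (card B) ^ card A" using partial_graphs_card[OF assms(1,2)] .
  have "1 \<le> card A" using assms(1,4) by (simp add: Suc_leI card_gt_0_iff)
  from message_length[OF this assms(5), of 2] obtain l where
    l: "(Suc (card B) ^ card A) ^ 2 \<le> 2 ^ l" "real l \<le> 6 * real (card A) * log 2 (real (card B))" by auto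
  have "\<exists>alice bob. semi_matching_protocol A B alice bob
      (6 * real (card A) * log 2 (real (card B))) ((2 * real (card A) powr (1/3) + 1) + 1)"
  proof (rule skeleton_protocol[OF assms(1-4)])
    show "finite ?K" using P(1) by simp
    have "card ?K \<le> card ?P * card ?P" using card_image_le[of "?P \<times> ?P"] P(1) by (simp add: card_cartesian_product)
    also have "\<dots> \<le> (Suc (card B) ^ card A) ^ 2"
      unfolding power2_eq_square using P(2) by (intro mult_mono) auto
    finally show "card ?K \<le> 2 ^ l" using l(1) by simp
    show "\<exists>T\<in>?K. skeleton E T (2 * real (card A) powr (1/3) + 1)"
      if E: "E \<subseteq> A \<times> B" for E
    proof -
      let ?V = "fst ` E"
      have V: "?V \<subseteq> A" "E \<subseteq> ?V \<times> B" using E by force+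
      then have fV: "finite ?V" using assms(1) finite_subset by blast
      obtain s where s: "balanced ?V E s"
        using balanced_exists[OF fV assms(2), of E] E by force
      have "\<exists>t. balanced {a \<in> ?V. s a = b} E t" for b
        using balanced_exists[of "{a \<in> ?V. s a = b}" B E] fV assms(2) E by force
      then obtain u where u: "\<And>b. balanced {a \<in> ?V. s a = b} E (u b)" by metis
      \<comment> \<open>The fibres of \<open>s\<close> are disjoint, so their balanced assignments
        glue to a single \<open>t\<close>.\<close>
      define t where "t a = u (s a) a" for a
      have t: "balanced {a \<in> ?V. s a = b} E t" for b
      proof -
        have "load {a \<in> ?V. s a = b} t c = load {a \<in> ?V. s a = b} (u b) c" for c
          unfolding load_def by (rule arg_cong[where f = card]) (auto simp: t_def)
        then show ?thesis using u[of b] unfolding balanced_def assignment_def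
          by (auto simp: t_def)
      qed
      have "s ` ?V \<subseteq> B" using s E by (auto simp: balanced_def assignment_def)
      then have 1: "(\<lambda>a. (a, s a)) ` ?V \<in> ?P" by (rule graph_in_partial_graphs[OF V(1)])
      have "(a, t a) \<in> E" if "a \<in> ?V" for a
        using t[of "s a"] that unfolding balanced_def assignment_def by blast
      then have "t ` ?V \<subseteq> B" using E by auto
      then have 2: "(\<lambda>a. (a, t a)) ` ?V \<in> ?P" by (rule graph_in_partial_graphs[OF V(1)])
      have "2 * real (card ?V) powr (1/3) + 1 \<le> 2 * real (card A) powr (1/3) + 1"
        using card_mono[OF assms(1) V(1)] by (auto intro: powr_mono2)
      then have "skeleton E ((\<lambda>a. (a, s a)) ` ?V \<union> (\<lambda>a. (a, t a)) ` ?V) (2 * real (card A) powr (1/3) + 1)"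
        by (rule skeleton_mono[OF two_level_skeleton[OF fV V(2) s t]])
      then show ?thesis using 1 2 by (intro bexI[of _ "(\<lambda>a. (a, s a)) ` ?V \<union> (\<lambda>a. (a, t a)) ` ?V"]) auto
    qed
  qed (use l in auto)
  then show ?thesis by (simp add: add.assoc)
qed

theorem theorem3:
  "\<exists>c::real. c > 0 \<and>
    (\<forall>(A :: 'v set) (B :: 'v set) (n :: nat) (m :: nat).
       finite A \<and> finite B \<and> A \<inter> B = {} \<and> n = card A \<and> m = card B \<longrightarrow>
       (\<exists>alice bob. semi_matching_protocol A B alice bob
          (c * real n * log 2 (real m)) (real n powr (1/2) + 2)) \<and>
       (\<exists>alice bob. semi_matching_protocol A B alice bob
          (2 * c * real n * log 2 (real m)) (2 * real n powr (1/3) + 2)))"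
proof (intro exI[of _ "3::real"] conjI allI impI)
  fix A B :: "'v set" and n m :: nat
  assume H: "finite A \<and> finite B \<and> A \<inter> B = {} \<and> n = card A \<and> m = card B"
  \<comment> \<open>\<open>log 2 0\<close> is 0 by convention, so the budget vanishes for empty
    \<open>B\<close> as well.\<close>
  have log0: "log 2 (real m) = 0" if "card B \<le> 1"
  proof -
    have "m = 0 \<or> m = 1" using that H by linarith
    then show ?thesis by (auto simp: log_def)
  qed
  show "\<exists>alice bob. semi_matching_protocol A B alice bob
      (3 * real n * log 2 (real m)) (real n powr (1/2) + 2)"
  proof (cases "A = {} \<or> card B \<le> 1")
    case True
    moreover have "0 \<le> 3 * real n * log 2 (real m)"
      using True H log0 by auto
    moreover have "1 \<le> real n powr (1/2) + 2" using powr_ge_zero[of "real n" "1/2"] by linarith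
    ultimately show ?thesis using H trivial_protocol by blast
  next
    case False
    then show ?thesis using H sqrt_protocol[of A B] by simp
  qed
  show "\<exists>alice bob. semi_matching_protocol A B alice bob
      (2 * 3 * real n * log 2 (real m)) (2 * real n powr (1/3) + 2)"
  proof (cases "A = {} \<or> card B \<le> 1")
    case True
    moreover have "0 \<le> 2 * 3 * real n * log 2 (real m)"
      using True H log0 by auto
    moreover have "1 \<le> 2 * real n powr (1/3) + 2" using powr_ge_zero[of "real n" "1/3"] by linarith
    ultimately show ?thesis using H trivial_protocol by blast
  next
    case False
    then show ?thesis using H cbrt_protocol[of A B] by simp
  qed
qed simp

end
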